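(* Let $\beta\in[0,1]$ and let $\gamma\in\mathbb{C}$ with $\operatorname{Re}\gamma\geq-\frac12$. If $f\in\mathcal{A}_\beta$, then the function $$ z\mapsto \frac{1+\gamma}{z^\gamma}\int_0^z t^{\gamma-1}f(t)\,dt $$ also belongs to $\mathcal{A}_\beta$.
   Context: $\mathbb{D}=\{z\in\mathbb{C}:|z|<1\}$. $\mathcal{A}$ is the class of functions $f$ holomorphic in $\mathbb{D}$ with $f(0)=0$ and $f'(0)=1$. For $\beta\in[0,1]$, $$\mathcal{A}_\beta=\left\{f\in\mathcal{A}:\operatorname{Re}\left(\beta\frac{f(z)}{z}+(1-\beta)f'(z)\right)>0 \text{ for all } z\in\mathbb{D}\right\},$$ where $f(z)/z$ is given the value $1$ at $z=0$. For $f(z)=\sum_{n\ge1}a_nz^n$ (with $a_1=1$), the integral expression in the claim denotes the holomorphic function $\sum_{n\ge1}\frac{1+\gamma}{n+\gamma}a_nz^n$ on $\mathbb{D}$. *)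

theory Defs
  imports "HOL-Complex_Analysis.Complex_Analysis"
begin

abbreviation unit_disc :: "complex set" where
  "unit_disc \<equiv> ball 0 1"

text \<open>
  Functions on the disc are total functions on the complex plane; the classes below
  constrain only their values on the disc.
\<close>

definition class_A :: "(complex \<Rightarrow> complex) set" where
  "class_A = {f. f holomorphic_on unit_disc \<and> f 0 = 0 \<and> deriv f 0 = 1}"

text \<open>The quotient \<open>f z / z\<close> with its removable singularity at 0 filled in.\<close>

definition quot_z :: "(complex \<Rightarrow> complex) \<Rightarrow> complex \<Rightarrow> complex" where
  "quot_z f z = (if z = 0 then 1 else f z / z)"

definition class_A_beta :: "real \<Rightarrow> (complex \<Rightarrow> complex) set" where
  "class_A_beta \<beta> = {f \<in> class_A. \<forall>z \<in> unit_disc.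
     Re (complex_of_real \<beta> * quot_z f z + complex_of_real (1 - \<beta>) * deriv f z) > 0}"

definition taylor_coeff :: "(complex \<Rightarrow> complex) \<Rightarrow> nat \<Rightarrow> complex" where
  "taylor_coeff f n = (deriv ^^ n) f 0 / fact n"

text \<open>
  The operator \<open>f \<mapsto> (1 + \<gamma>) / z^\<gamma> * \<integral>\<^sub>0\<^sup>z t^(\<gamma> - 1) f(t) dt\<close>, read as the power series
  \<open>\<Sum>n\<ge>1. (1 + \<gamma>) / (n + \<gamma>) * a\<^sub>n * z^n\<close> obtained by integrating the Taylor series
  \<open>f(t) = \<Sum>n\<ge>1. a\<^sub>n * t^n\<close> termwise. The index is shifted, so that \<open>Suc n\<close> plays the role
  of \<open>n\<close>. Only its values on the disc are meaningful.
\<close>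

definition bernardi :: "complex \<Rightarrow> (complex \<Rightarrow> complex) \<Rightarrow> complex \<Rightarrow> complex" where
  "bernardi \<gamma> f z =
     (\<Sum>n. (1 + \<gamma>) / (of_nat (Suc n) + \<gamma>) * taylor_coeff f (Suc n) * z ^ Suc n)"

end

theory Submission
  imports Defs
begin

text \<open>
  Write \<open>F = bernardi \<gamma> f\<close>. Since \<open>F\<close> multiplies the \<open>n\<close>-th Taylor coefficient of \<open>f\<close> by
  \<open>(1 + \<gamma>) / (n + \<gamma>)\<close>, and \<open>z * d/dz\<close> multiplies it by \<open>n\<close>, the operator is inverted by a
  first-order differential equation, \<open>\<gamma> * F + z * F' = (1 + \<gamma>) * f\<close> (lemma \<open>bernardi_ode\<close>).
  Dividing this equation by \<open>z\<close>, or differentiating it, shows that the pairs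
  \<open>(F z / z, f z / z)\<close> and \<open>(F', f')\<close> both solve \<open>(1 + \<gamma>) * Q + z * Q' = (1 + \<gamma>) * P\<close>.
  This equation is linear, so it also holds for
  \<open>q = \<beta> * F z / z + (1 - \<beta>) * F'\<close> and \<open>p = \<beta> * f z / z + (1 - \<beta>) * f'\<close>; that is,
  \<open>q + z * q' / (1 + \<gamma>) = p\<close>.

  It remains to see that \<open>Re p > 0\<close> forces \<open>Re q > 0\<close>, which is a differential subordination
  argument in the manner of Miller and Mocanu (lemma \<open>Re_pos_if_Re_first_order_pos\<close>). At a
  minimum \<open>w\<close> of \<open>Re q\<close> on a closed disc about 0, the number \<open>w * q' w\<close> is real and at most 0:
  its imaginary part is, up to sign, a tangential derivative and its real part a radial one. As
  \<open>1 / (1 + \<gamma>)\<close> has nonnegative real part, \<open>Re (p w) \<le> Re (q w)\<close>, so this minimum is positive.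
\<close>

section \<open>A first-order differential subordination\<close>

text \<open>
  If the claim fails at \<open>z\<close>, the minimum of \<open>Re q\<close> over the closed disc of radius \<open>norm z\<close> is at
  most 0, and the assumed inequality is violated where the minimum is attained. The disc is
  invariant under rotations and under shrinking towards 0, and these two motions give the sign
  conditions on \<open>w * deriv q w\<close>. The minimum may be attained inside the disc; the argument is the
  same there.
\<close>

lemma Re_pos_if_Re_first_order_pos:
  fixes q :: "complex \<Rightarrow> complex" and c :: complex
  assumes hol: "q holomorphic_on unit_disc"
    and c: "0 \<le> Re c"
    and pos: "\<And>z. z \<in> unit_disc \<Longrightarrow> 0 < Re (q z + c * (z * deriv q z))"
    and z: "z \<in> unit_disc"
  shows "0 < Re (q z)"
proof (rule ccontr)
  assume neg: "\<not> 0 < Re (q z)"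
  define K where "K = cball (0 :: complex) (norm z)"
  have K: "K \<subseteq> unit_disc" "z \<in> K" "compact K"
    using z by (auto simp: K_def)
  have "continuous_on K (\<lambda>w. Re (q w))"
    by (intro continuous_intros continuous_on_subset[OF holomorphic_on_imp_continuous_on[OF hol] K(1)])
  then obtain w where w: "w \<in> K" and min: "\<And>v. v \<in> K \<Longrightarrow> Re (q w) \<le> Re (q v)"
    using continuous_attains_inf[OF K(3)] K(2) by blast
  have wD: "w \<in> unit_disc"
    using w K by blast
  have dq: "(q has_field_derivative deriv q w) (at w)"
    using hol wD by (simp add: holomorphic_derivI)

  \<comment> \<open>Moving from \<open>w\<close> towards 0 stays in the disc, so \<open>\<phi>\<close> cannot increase strictly at 1.\<close>
  define \<phi> where "\<phi> = (\<lambda>t :: real. Re (q (complex_of_real t * w)))"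
  have "((\<lambda>t. q (complex_of_real t * w)) has_vector_derivative w * deriv q w) (at 1)"
  proof -
    have "((\<lambda>t. complex_of_real t * w) has_vector_derivative w) (at 1)"
      by (auto intro!: derivative_eq_intros)
    from field_vector_diff_chain_at[OF this, of q "deriv q w"] dq show ?thesis
      by (simp add: o_def)
  qed
  then have d\<phi>: "(\<phi> has_real_derivative Re (w * deriv q w)) (at 1)"
    unfolding \<phi>_def has_real_derivative_iff_has_vector_derivative
    by (rule bounded_linear.has_vector_derivative[OF bounded_linear_Re])
  have radial: "Re (w * deriv q w) \<le> 0"
  proof (rule ccontr)
    assume "\<not> Re (w * deriv q w) \<le> 0"
    then obtain d where d: "d > 0" "\<And>h. h > 0 \<Longrightarrow> h < d \<Longrightarrow> \<phi> (1 - h) < \<phi> 1"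
      using DERIV_pos_inc_left[OF d\<phi>] by auto
    \<comment> \<open>The bound 1 keeps the factor \<open>1 - h\<close> nonnegative.\<close>
    define h where "h = min (d / 2) 1"
    have h: "0 < h" "h < d" "h \<le> 1"
      using d(1) by (auto simp: h_def min_def)
    have "norm (complex_of_real (1 - h) * w) \<le> norm w"
      unfolding norm_mult norm_of_real using h
      by (intro mult_left_le_one_le) auto
    then have "complex_of_real (1 - h) * w \<in> K"
      using w by (simp add: K_def)
    with min d(2)[OF h(1,2)] show False
      by (force simp: \<phi>_def)
  qed

  \<comment> \<open>The whole circle through \<open>w\<close> lies in the disc, so \<open>\<psi>\<close> has a minimum at 0.\<close>
  define \<psi> where "\<psi> = (\<lambda>t :: real. Re (q (exp (\<i> * complex_of_real t) * w)))"
  have "((\<lambda>t. q (exp (\<i> * complex_of_real t) * w)) has_vector_derivative \<i> * w * deriv q w) (at 0)"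
  proof -
    have "((\<lambda>u. exp (\<i> * u) * w) has_field_derivative \<i> * w) (at (complex_of_real 0))"
      by (auto intro!: derivative_eq_intros)
    then have "((\<lambda>t. exp (\<i> * complex_of_real t) * w) has_vector_derivative \<i> * w) (at 0)"
      by (rule has_vector_derivative_real_field)
    from field_vector_diff_chain_at[OF this, of q "deriv q w"] dq show ?thesis
      by (simp add: o_def)
  qed
  then have d\<psi>: "(\<psi> has_real_derivative Re (\<i> * w * deriv q w)) (at 0)"
    unfolding \<psi>_def has_real_derivative_iff_has_vector_derivative
    by (rule bounded_linear.has_vector_derivative[OF bounded_linear_Re])
  have "\<psi> 0 \<le> \<psi> t" for t
    using min[of "exp (\<i> * complex_of_real t) * w"] w
    by (simp add: \<psi>_def K_def norm_mult)
  then have "Re (\<i> * w * deriv q w) = 0"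
    using DERIV_local_min[OF d\<psi>, of 1] by simp
  then have tangential: "Im (w * deriv q w) = 0"
    by (simp add: mult.assoc)

  have "Re (q w) \<le> 0"
    using min[OF K(2)] neg by linarith
  moreover have "Re (c * (w * deriv q w)) = Re c * Re (w * deriv q w)"
    by (subst times_complex.sel(1)) (simp add: tangential del: times_complex.sel)
  moreover have "\<dots> \<le> 0"
    using c radial by (simp add: mult_nonneg_nonpos del: times_complex.sel)
  ultimately show False
    using pos[OF wD] by (simp del: times_complex.sel)
qed

section \<open>The quotient of a normalised function by the identity\<close>

lemma holomorphic_quot_z:
  assumes "f \<in> class_A"
  shows "quot_z f holomorphic_on unit_disc"
proof (rule no_isolated_singularity'[where K = "{0}"])
  have f: "f holomorphic_on unit_disc" "f 0 = 0" "deriv f 0 = 1"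
    using assms by (auto simp: class_A_def)
  have "(\<lambda>z. f z / z) holomorphic_on unit_disc - {0}"
    by (intro holomorphic_intros holomorphic_on_subset[OF f(1)]) auto
  then show "quot_z f holomorphic_on unit_disc - {0}"
    by (rule holomorphic_transform) (auto simp: quot_z_def)
  have "(f has_field_derivative 1) (at 0)"
    using holomorphic_derivI[OF f(1), of 0] f(3) by simp
  then have "((\<lambda>z. f z / z) \<longlongrightarrow> 1) (at 0)"
    using f(2) by (simp add: has_field_derivative_iff)
  then have "(quot_z f \<longlongrightarrow> 1) (at 0)"
    by (rule Lim_transform_eventually)
       (auto simp: quot_z_def eventually_at_filter)
  then show "(quot_z f \<longlongrightarrow> quot_z f z) (at z within unit_disc)" if "z \<in> {0}" for z
    using that by (auto simp: quot_z_def[of f 0] intro: tendsto_within_subset)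
qed auto

text \<open>
  This is the product rule for \<open>f z = z * quot_z f z\<close>. It turns the differential equation for
  \<open>F\<close> into one for the quotient \<open>F z / z\<close>.
\<close>

lemma deriv_quot_z:
  assumes "f \<in> class_A" and z: "z \<in> unit_disc"
  shows "z * deriv (quot_z f) z = deriv f z - quot_z f z"
proof (cases "z = 0")
  case True
  then show ?thesis
    using assms by (simp add: class_A_def quot_z_def)
next
  case False
  have f: "f holomorphic_on unit_disc" "f 0 = 0"
    using assms by (auto simp: class_A_def)
  have Q: "(quot_z f has_field_derivative deriv (quot_z f) z) (at z)"
    by (rule holomorphic_derivI[OF holomorphic_quot_z[OF assms(1)] _ z]) simp
  have "((\<lambda>w. w * quot_z f w) has_field_derivative quot_z f z + z * deriv (quot_z f) z) (at z)"
    by (auto intro!: derivative_eq_intros Q)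
  moreover have "(\<lambda>w. w * quot_z f w) = f"
    using f(2) by (auto simp: quot_z_def)
  ultimately show ?thesis
    by (simp add: DERIV_imp_deriv)
qed

section \<open>The differential equation of the Bernardi transform\<close>

text \<open>
  The coefficients \<open>d n\<close> of the transform satisfy \<open>(n + \<gamma>) * d n = (1 + \<gamma>) * a n\<close>, and summing
  these identities gives the equation. The factors \<open>(1 + \<gamma>) / (n + \<gamma>)\<close> are bounded over
  \<open>n \<ge> 1\<close> because \<open>Re (n + \<gamma>) \<ge> 1 + Re \<gamma> > 0\<close>; hence the transformed series still converges on
  the whole disc.
\<close>

lemma bernardi_ode:
  assumes \<gamma>: "- 1 < Re \<gamma>" and hol: "f holomorphic_on unit_disc" and f0: "f 0 = 0"
  shows "bernardi \<gamma> f holomorphic_on unit_disc"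
    and "z \<in> unit_disc \<Longrightarrow>
      \<gamma> * bernardi \<gamma> f z + z * deriv (bernardi \<gamma> f) z = (1 + \<gamma>) * f z"
proof -
  define a where "a = taylor_coeff f"
  define d where "d = (\<lambda>n. (1 + \<gamma>) / (of_nat n + \<gamma>) * a n)"
  \<comment> \<open>This makes the index 0 harmless below, also for \<open>\<gamma> = 0\<close>, where \<open>d 0\<close> is a division by 0.\<close>
  have a0: "a 0 = 0"
    by (simp add: a_def taylor_coeff_def f0)
  have d: "(of_nat n + \<gamma>) * d n = (1 + \<gamma>) * a n" for n
  proof (cases n)
    case (Suc m)
    have "Re (of_nat n + \<gamma>) > 0"
      using \<gamma> Suc by simp
    then have "of_nat n + \<gamma> \<noteq> 0"
      by (metis less_irrefl zero_complex.sel(1))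
    then show ?thesis
      by (simp add: d_def)
  qed (simp add: d_def a0)
  have f_sums: "(\<lambda>n. a n * w ^ n) sums f w" if "w \<in> unit_disc" for w
    using holomorphic_power_series[OF hol that] by (simp add: a_def taylor_coeff_def)
  have d_bound: "norm (d n) \<le> norm (1 + \<gamma>) / (1 + Re \<gamma>) * norm (a n)" for n
  proof (cases n)
    case (Suc m)
    have "1 + Re \<gamma> \<le> Re (of_nat n + \<gamma>)"
      using Suc by simp
    also have "\<dots> \<le> norm (of_nat n + \<gamma>)"
      by (rule complex_Re_le_cmod)
    finally have "norm (1 + \<gamma>) / norm (of_nat n + \<gamma>) \<le> norm (1 + \<gamma>) / (1 + Re \<gamma>)"
      using \<gamma> by (intro divide_left_mono mult_pos_pos) auto
    then show ?thesis
      unfolding d_def norm_mult norm_divide by (rule mult_right_mono) simp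
  qed (simp add: d_def a0)
  have d_summable: "summable (\<lambda>n. d n * w ^ n)" if w: "w \<in> unit_disc" for w
  proof -
    \<comment> \<open>The series of \<open>f\<close> converges absolutely at \<open>w\<close>, as it converges at a point farther out.\<close>
    obtain r where r: "norm w < r" "r < 1"
      using w dense[of "norm w" 1] by auto
    have "summable (\<lambda>n. a n * complex_of_real r ^ n)"
      using f_sums[of "complex_of_real r"] r norm_ge_zero[of w]
      by (auto simp: sums_iff simp del: norm_ge_zero)
    then have "summable (\<lambda>n. norm (a n * w ^ n))"
      by (rule powser_insidea) (use r norm_ge_zero[of w] in \<open>auto simp del: norm_ge_zero\<close>)
    then have "summable (\<lambda>n. norm (1 + \<gamma>) / (1 + Re \<gamma>) * norm (a n * w ^ n))"
      by (rule summable_mult)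
    then show ?thesis
    proof (rule summable_comparison_test')
      show "norm (d n * w ^ n) \<le> norm (1 + \<gamma>) / (1 + Re \<gamma>) * norm (a n * w ^ n)" for n
        using mult_right_mono[OF d_bound[of n], of "norm (w ^ n)"]
        by (simp add: norm_mult mult.assoc)
    qed
  qed
  have F_sums: "(\<lambda>n. d n * w ^ n) sums bernardi \<gamma> f w" if "w \<in> unit_disc" for w
  proof -
    have "(\<lambda>n. d n * w ^ n) sums (\<Sum>n. d n * w ^ n)"
      using d_summable[OF that] by (rule summable_sums)
    also have "(\<Sum>n. d n * w ^ n) = (\<Sum>n. d (Suc n) * w ^ Suc n)"
      using suminf_split_head[OF d_summable[OF that]] by (simp add: d_def a0)
    also have "\<dots> = bernardi \<gamma> f w"
      by (simp add: bernardi_def d_def a_def)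
    finally show ?thesis .
  qed
  show F_hol: "bernardi \<gamma> f holomorphic_on unit_disc"
    by (rule power_series_holomorphic[where a = d]) (use F_sums in simp)
  show "\<gamma> * bernardi \<gamma> f z + z * deriv (bernardi \<gamma> f) z = (1 + \<gamma>) * f z"
    if z: "z \<in> unit_disc"
  proof -
    have "(\<lambda>n. diffs d n * z ^ n) sums deriv (bernardi \<gamma> f) z"
      by (rule termdiffs_sums_strong[where K = 1 and f = "bernardi \<gamma> f"])
         (use F_sums z holomorphic_derivI[OF F_hol _ z] in auto)
    then have "(\<lambda>n. z * (diffs d n * z ^ n)) sums (z * deriv (bernardi \<gamma> f) z)"
      by (rule sums_mult)
    then have "(\<lambda>n. of_nat (Suc n) * d (Suc n) * z ^ Suc n) sums (z * deriv (bernardi \<gamma> f) z)"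
      by (simp add: diffs_def algebra_simps)
    then have "(\<lambda>n. of_nat n * d n * z ^ n) sums (z * deriv (bernardi \<gamma> f) z)"
      using sums_Suc_iff[of "\<lambda>n. of_nat n * d n * z ^ n"] by simp
    from sums_add[OF sums_mult[OF F_sums[OF z], of \<gamma>] this]
    have "(\<lambda>n. (of_nat n + \<gamma>) * d n * z ^ n) sums
        (\<gamma> * bernardi \<gamma> f z + z * deriv (bernardi \<gamma> f) z)"
      by (simp add: algebra_simps)
    moreover have "(\<lambda>n. (of_nat n + \<gamma>) * d n * z ^ n) sums ((1 + \<gamma>) * f z)"
      unfolding d using sums_mult[OF f_sums[OF z], of "1 + \<gamma>"] by (simp add: mult.assoc)
    ultimately show ?thesis
      by (rule sums_unique2)
  qed
qed

lemma deriv_bernardi_ode: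
  assumes \<gamma>: "- 1 < Re \<gamma>" and hol: "f holomorphic_on unit_disc" and f0: "f 0 = 0"
    and z: "z \<in> unit_disc"
  shows "(1 + \<gamma>) * deriv (bernardi \<gamma> f) z + z * deriv (deriv (bernardi \<gamma> f)) z
    = (1 + \<gamma>) * deriv f z"
proof -
  let ?F = "bernardi \<gamma> f"
  have F: "?F holomorphic_on unit_disc"
    using bernardi_ode(1)[OF \<gamma> hol f0] .
  have dF: "(?F has_field_derivative deriv ?F z) (at z)"
    and ddF: "(deriv ?F has_field_derivative deriv (deriv ?F) z) (at z)"
    and df: "(f has_field_derivative deriv f z) (at z)"
    using z by (auto intro!: holomorphic_derivI[OF _ _ z] holomorphic_deriv F hol)
  have "((\<lambda>w. \<gamma> * ?F w + w * deriv ?F w) has_field_derivative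
      (1 + \<gamma>) * deriv ?F z + z * deriv (deriv ?F) z) (at z)"
    by (auto intro!: derivative_eq_intros dF ddF simp: algebra_simps)
  then have "((\<lambda>w. (1 + \<gamma>) * f w) has_field_derivative
      (1 + \<gamma>) * deriv ?F z + z * deriv (deriv ?F) z) (at z)"
    by (rule has_field_derivative_transform_within_open[where S = unit_disc])
       (use z bernardi_ode(2)[OF \<gamma> hol f0] in auto)
  moreover have "((\<lambda>w. (1 + \<gamma>) * f w) has_field_derivative (1 + \<gamma>) * deriv f z) (at z)"
    by (rule DERIV_cmult[OF df])
  ultimately show ?thesis
    by (rule DERIV_unique)
qed

section \<open>Invariance of the classes\<close>

text \<open>
  The normalisation \<open>deriv F 0 = 1\<close> is the differentiated equation at 0, where its second-order
  term vanishes.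
\<close>

lemma bernardi_class_A:
  assumes \<gamma>: "- 1 < Re \<gamma>" and f: "f \<in> class_A"
  shows "bernardi \<gamma> f \<in> class_A"
proof -
  have fA: "f holomorphic_on unit_disc" "f 0 = 0" "deriv f 0 = 1"
    using f by (auto simp: class_A_def)
  have "1 + \<gamma> \<noteq> 0"
    using \<gamma> by (auto simp: complex_eq_iff)
  then have "deriv (bernardi \<gamma> f) 0 = 1"
    using deriv_bernardi_ode[OF \<gamma> fA(1,2), of 0] fA(3) by simp
  moreover have "bernardi \<gamma> f 0 = 0"
    by (simp add: bernardi_def)
  ultimately show ?thesis
    using bernardi_ode(1)[OF \<gamma> fA(1,2)] by (simp add: class_A_def)
qed

text \<open>
  The half-plane \<open>Re \<gamma> > - 1\<close> is the natural range: there \<open>1 + \<gamma>\<close>, and with it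
  \<open>1 / (1 + \<gamma>)\<close>, has positive real part, so the subordination argument applies.
\<close>

lemma bernardi_class_A_beta:
  assumes \<gamma>: "- 1 < Re \<gamma>" and f: "f \<in> class_A_beta \<beta>"
  shows "bernardi \<gamma> f \<in> class_A_beta \<beta>"
proof -
  define F where "F = bernardi \<gamma> f"
  define p q where
    "p = (\<lambda>z. complex_of_real \<beta> * quot_z f z + complex_of_real (1 - \<beta>) * deriv f z)" and
    "q = (\<lambda>z. complex_of_real \<beta> * quot_z F z + complex_of_real (1 - \<beta>) * deriv F z)"
  have fA: "f \<in> class_A" "f holomorphic_on unit_disc" "f 0 = 0"
    and p_pos: "\<And>z. z \<in> unit_disc \<Longrightarrow> 0 < Re (p z)"
    using f by (auto simp: class_A_beta_def class_A_def p_def)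
  have FA: "F \<in> class_A"
    using bernardi_class_A[OF \<gamma> fA(1)] by (simp add: F_def)
  have F_hol: "F holomorphic_on unit_disc" and F': "deriv F holomorphic_on unit_disc"
    using FA by (auto simp: class_A_def intro: holomorphic_deriv)
  have c: "1 + \<gamma> \<noteq> 0" "0 \<le> Re (1 / (1 + \<gamma>))"
    using \<gamma> by (auto simp: complex_eq_iff Re_divide)
  have q_hol: "q holomorphic_on unit_disc"
    unfolding q_def by (intro holomorphic_intros holomorphic_quot_z FA F')
  have ode: "q z + 1 / (1 + \<gamma>) * (z * deriv q z) = p z" if z: "z \<in> unit_disc" for z
  proof -
    have "(q has_field_derivative
        complex_of_real \<beta> * deriv (quot_z F) z + complex_of_real (1 - \<beta>) * deriv (deriv F) z) (at z)"
      unfolding q_def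
      by (intro DERIV_add DERIV_cmult holomorphic_derivI[OF _ _ z] holomorphic_quot_z FA F' open_ball)
    then have dq: "deriv q z =
        complex_of_real \<beta> * deriv (quot_z F) z + complex_of_real (1 - \<beta>) * deriv (deriv F) z"
      by (rule DERIV_imp_deriv)
    have "(1 + \<gamma>) * q z + z * deriv q z =
        complex_of_real \<beta> * ((1 + \<gamma>) * quot_z F z + z * deriv (quot_z F) z) +
        complex_of_real (1 - \<beta>) * ((1 + \<gamma>) * deriv F z + z * deriv (deriv F) z)"
      unfolding dq by (simp add: q_def algebra_simps)
    also have "(1 + \<gamma>) * quot_z F z + z * deriv (quot_z F) z = (1 + \<gamma>) * quot_z f z"
    proof (cases "z = 0")
      case False
      then have "(1 + \<gamma>) * quot_z F z + z * deriv (quot_z F) z = (\<gamma> * F z + z * deriv F z) / z"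
        unfolding deriv_quot_z[OF FA z] by (simp add: quot_z_def add_divide_distrib algebra_simps)
      also have "\<dots> = (1 + \<gamma>) * f z / z"
        using bernardi_ode(2)[OF \<gamma> fA(2,3) z] by (simp add: F_def)
      finally show ?thesis
        using False by (simp add: quot_z_def)
    qed (simp add: quot_z_def)
    also have "(1 + \<gamma>) * deriv F z + z * deriv (deriv F) z = (1 + \<gamma>) * deriv f z"
      using deriv_bernardi_ode[OF \<gamma> fA(2,3) z] by (simp add: F_def)
    finally have "(1 + \<gamma>) * q z + z * deriv q z = (1 + \<gamma>) * p z"
      by (simp add: p_def algebra_simps)
    then show ?thesis
      using c(1) by (simp add: field_simps)
  qed
  have "0 < Re (q z)" if "z \<in> unit_disc" for z
    by (rule Re_pos_if_Re_first_order_pos[OF q_hol c(2) _ that]) (simp only: ode p_pos)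
  then show ?thesis
    using FA by (simp add: class_A_beta_def q_def F_def)
qed

theorem corollary2p7:
  fixes \<beta> :: real and \<gamma> :: complex and f :: "complex \<Rightarrow> complex"
  assumes "0 \<le> \<beta>" and "\<beta> \<le> 1"
    and "Re \<gamma> \<ge> - 1 / 2"
    and "f \<in> class_A_beta \<beta>"
  shows "bernardi \<gamma> f \<in> class_A_beta \<beta>"
  using bernardi_class_A_beta[of \<gamma> f \<beta>] assms(3,4) by simp

end
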